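(* Let $d \ge k \ge 0$ be integers. Let $G=(\mathbb{Z}_2)^{d-k+1}$, where $\mathbb{Z}_2=\{+1,-1\}$ under multiplication, with generators $m_0,m_1,\dots,m_{d-k}$ ($m_i$ has $-1$ in the coordinate indexed by $i$ and $+1$ elsewhere). Let $G$ act on $X = S^d \times V_{d-k}(\mathbb{R}^d)$ by $$(\lambda_0,\lambda_1,\dots,\lambda_{d-k})\cdot(w,v_1,\dots,v_{d-k}) = (\lambda_0 w, \lambda_1 v_1,\dots,\lambda_{d-k}v_{d-k}),$$ and let $G$ act on $R=\mathbb{R}^d\times\mathbb{R}^{d-1}\times\cdots\times\mathbb{R}^k$, whose elements are written $(x_0,x_1,\dots,x_{d-k})$ with $x_i\in\mathbb{R}^{d-i}$, as follows: for $1\le i\le d-k$, $m_i$ changes the sign of every coordinate of $x_i$ and leaves everything else unchanged; $m_0$ changes the sign of every coordinate of $x_0$ and of the first coordinate of each of $x_1,\dots,x_{d-k}$, leaving all other coordinates unchanged. Then every continuous $G$-equivariant map $f: X \to R$ has a zero.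
   Context: $S^d\subset\mathbb{R}^{d+1}$ is the unit sphere. $V_{j}(\mathbb{R}^d)$ denotes the Stiefel manifold of ordered orthonormal $j$-frames $(v_1,\dots,v_j)$ in $\mathbb{R}^d$; $V_0(\mathbb{R}^d)$ is a point. When $k=d$, $R=\mathbb{R}^d$ and the factors $\mathbb{R}^0=\{0\}$ are trivial. *)

theory Defs
  imports "HOL-Analysis.Analysis"
begin

text \<open>Encoding. A point of X = S^d x V_{d-k}(R^d) is x :: nat => nat => real with
  x 0 = w in S^d (coordinates 0..d, zero beyond) and x i = v_i for 1 <= i <= d-k
  (coordinates 0..d-1, zero beyond); x i = 0 for i > d-k.
  A point of R = R^d x R^(d-1) x ... x R^k is y :: nat => nat => real with
  y i in R^(d-i) (coordinates 0..d-i-1) for i <= d-k, all other entries zero.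
  The type nat => nat => real carries the product topology, which induces the
  Euclidean topology on these finite-dimensional carriers.\<close>

definition X_space :: "nat \<Rightarrow> nat \<Rightarrow> (nat \<Rightarrow> nat \<Rightarrow> real) set" where
  "X_space d k = {x.
     (\<forall>j. d < j \<longrightarrow> x 0 j = 0) \<and> (\<Sum>j\<le>d. (x 0 j)\<^sup>2) = 1 \<and>
     (\<forall>i. d - k < i \<longrightarrow> (\<forall>j. x i j = 0)) \<and>
     (\<forall>i\<in>{1..d-k}. \<forall>j. d \<le> j \<longrightarrow> x i j = 0) \<and>
     (\<forall>i\<in>{1..d-k}. \<forall>l\<in>{1..d-k}. (\<Sum>j<d. x i j * x l j) = (if i = l then 1 else 0))}"

definition R_space :: "nat \<Rightarrow> nat \<Rightarrow> (nat \<Rightarrow> nat \<Rightarrow> real) set" where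
  "R_space d k = {y. \<forall>i j. (d - k < i \<or> d - i \<le> j) \<longrightarrow> y i j = 0}"

definition G_group :: "nat \<Rightarrow> nat \<Rightarrow> (nat \<Rightarrow> real) set" where
  "G_group d k = {lam. (\<forall>i\<le>d-k. lam i = 1 \<or> lam i = -1) \<and> (\<forall>i. d - k < i \<longrightarrow> lam i = 1)}"

definition act_X :: "(nat \<Rightarrow> real) \<Rightarrow> (nat \<Rightarrow> nat \<Rightarrow> real) \<Rightarrow> (nat \<Rightarrow> nat \<Rightarrow> real)" where
  "act_X lam x = (\<lambda>i j. lam i * x i j)"

definition act_R :: "(nat \<Rightarrow> real) \<Rightarrow> (nat \<Rightarrow> nat \<Rightarrow> real) \<Rightarrow> (nat \<Rightarrow> nat \<Rightarrow> real)" where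
  "act_R lam y = (\<lambda>i j. (if i = 0 then lam 0 else lam i * (if j = 0 then lam 0 else 1)) * y i j)"

end

theory Submission
  imports Defs "HOL-Library.Z2" "HOL-Real_Asymp.Real_Asymp"
begin

text \<open>
  Replace the Stiefel manifold by a product of spheres, adding the equations \<open>v\<^sub>l \<bullet> v\<^sub>i = 0\<close>: after
  extending \<open>f\<close> by Tietze's theorem and symmetrising over \<open>G\<close>, this yields as many real equations as
  the product of spheres has dimensions, each of them even or odd in every block.

  For such a system consider the signs of the functions at the vertices of a fine mod 2 chain that
  represents a product of hemispheres. The cup product of the resulting 1-cochains counts the
  simplices along whose successive edges the successive functions change sign. Since the boundary of
  a hemisphere is the sum of two antipodal hemispheres of lower dimension, Stokes' formula evaluates
  this count recursively as a coefficient of a product of linear forms over the field with two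
  elements (the top Stiefel-Whitney class). Here the system is triangular, so the coefficient is 1,
  and arbitrarily small simplices with all sign changes exist; they accumulate at a common zero.
\<close>

section \<open>Mod 2 cochains\<close>

type_synonym 'a cochain = "'a list \<Rightarrow> bit"

declare add_bit_eq_xor [simp del] mult_bit_eq_and [simp del]

lemma bit_add_cancel [simp]: "x + x = (0::bit)" "x + (x + y) = (y::bit)"
  by (cases x; simp add: add_bit_eq_xor)
     (cases x; cases y; simp add: add_bit_eq_xor)

text \<open>Chains never occur explicitly: a mod 2 chain is represented by the functional that it induces
  on cochains, so that operators on chains appear here as their transposes. The value of
  \<open>coboundary\<close> at a vertex is the augmentation term \<open>\<phi> []\<close>.\<close>

primrec coboundary :: "'a cochain \<Rightarrow> 'a cochain" where
  "coboundary \<phi> [] = 0"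
| "coboundary \<phi> (x # xs) = \<phi> xs + coboundary (\<lambda>\<tau>. \<phi> (x # \<tau>)) xs"

text \<open>Transpose of the prism operator of the homotopy from \<open>f\<close> to \<open>g\<close>.\<close>

primrec prism :: "('a \<Rightarrow> 'b) \<Rightarrow> ('a \<Rightarrow> 'b) \<Rightarrow> 'b cochain \<Rightarrow> 'a cochain" where
  "prism f g \<phi> [] = 0"
| "prism f g \<phi> (x # xs) = \<phi> (f x # g x # map g xs) + prism f g (\<lambda>\<tau>. \<phi> (f x # \<tau>)) xs"

lemma coboundary_add: "coboundary (\<lambda>\<tau>. \<phi> \<tau> + \<psi> \<tau>) \<sigma> = coboundary \<phi> \<sigma> + coboundary \<psi> \<sigma>"
  by (induction \<sigma> arbitrary: \<phi> \<psi>) (simp_all add: ac_simps)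

lemma coboundary_cmult: "coboundary (\<lambda>\<tau>. c * \<phi> \<tau>) \<sigma> = c * coboundary \<phi> \<sigma>"
  by (induction \<sigma> arbitrary: \<phi>) (simp_all add: distrib_left)

lemma coboundary_zero: "coboundary (\<lambda>\<tau>. 0) \<sigma> = 0"
  by (induction \<sigma>) simp_all

lemma coboundary_sum: "coboundary (\<lambda>\<tau>. \<Sum>t<M. \<phi> t \<tau>) \<sigma> = (\<Sum>t<(M::nat). coboundary (\<phi> t) \<sigma>)"
  by (induction M) (simp_all add: coboundary_add coboundary_zero)

lemma coboundary_map: "coboundary \<phi> (map a \<sigma>) = coboundary (\<lambda>\<tau>. \<phi> (map a \<tau>)) \<sigma>"
  by (induction \<sigma> arbitrary: \<phi>) simp_all

lemma prism_add: "prism f g (\<lambda>\<tau>. \<phi> \<tau> + \<psi> \<tau>) \<sigma> = prism f g \<phi> \<sigma> + prism f g \<psi> \<sigma>"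
  by (induction \<sigma> arbitrary: \<phi> \<psi>) (simp_all add: ac_simps)

lemma prism_map: "prism f g \<phi> (map a \<sigma>) = prism (f \<circ> a) (g \<circ> a) \<phi> \<sigma>"
  by (induction \<sigma> arbitrary: \<phi>) simp_all

lemma prism_comp: "prism f g (\<lambda>\<tau>. \<phi> (map a \<tau>)) \<sigma> = prism (a \<circ> f) (a \<circ> g) \<phi> \<sigma>"
  by (induction \<sigma> arbitrary: \<phi>) simp_all

text \<open>Induction on the first vertex \<open>x\<close>: the terms
  \<open>\<phi> (f x # map g xs)\<close>, \<open>prism f g \<phi> xs\<close> and the faces of
  \<open>f x # g x # map g xs\<close> that keep \<open>f x\<close> and \<open>g x\<close> each occur
  twice and cancel mod 2.\<close>

lemma prism_homotopy:
  "prism f g (coboundary \<phi>) \<sigma> + coboundary (prism f g \<phi>) \<sigma> = \<phi> (map f \<sigma>) + \<phi> (map g \<sigma>)"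
proof (induction \<sigma> arbitrary: \<phi>)
  case (Cons x xs)
  show ?case
    using Cons[of "\<lambda>\<tau>. \<phi> (f x # \<tau>)"]
    by (simp add: prism_add coboundary_add coboundary_map ac_simps)
qed simp

text \<open>Tuples of the prism run through \<open>f\<close>-images and then
  \<open>g\<close>-images, with one vertical edge from \<open>f u\<close> to \<open>g u\<close>. The
  condition on \<open>hd \<tau>\<close> lets the induction prepend \<open>f x\<close> and keep
  consecutive vertices related.\<close>

lemma prism_cong:
  assumes "\<And>\<tau>. set \<tau> \<subseteq> f ` set \<sigma> \<union> g ` set \<sigma> \<Longrightarrow> successively Q \<tau> \<Longrightarrow>
      \<sigma> \<noteq> [] \<Longrightarrow> \<tau> \<noteq> [] \<Longrightarrow> hd \<tau> = f (hd \<sigma>) \<Longrightarrow> \<phi> \<tau> = \<psi> \<tau>"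
    and "successively R \<sigma>"
    and "\<And>u v. R u v \<Longrightarrow> Q (f u) (f v)" "\<And>u v. R u v \<Longrightarrow> Q (g u) (g v)"
    and "\<And>u. u \<in> set \<sigma> \<Longrightarrow> Q (f u) (g u)"
  shows "prism f g \<phi> \<sigma> = prism f g \<psi> \<sigma>"
  using assms
proof (induction \<sigma> arbitrary: \<phi> \<psi>)
  case (Cons x xs)
  have "\<phi> (f x # g x # map g xs) = \<psi> (f x # g x # map g xs)"
  proof (rule Cons.prems(1))
    have "successively Q (map g (x # xs))"
      using successively_mono[OF Cons.prems(2), of "\<lambda>u v. Q (g u) (g v)"] Cons.prems(4)
      by (simp only: successively_map)
    then show "successively Q (f x # g x # map g xs)"
      using Cons.prems(5) by auto
  qed auto
  moreover have "prism f g (\<lambda>\<tau>. \<phi> (f x # \<tau>)) xs = prism f g (\<lambda>\<tau>. \<psi> (f x # \<tau>)) xs"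
  proof (rule Cons.IH)
    fix \<tau> assume \<tau>: "set \<tau> \<subseteq> f ` set xs \<union> g ` set xs" "successively Q \<tau>" "xs \<noteq> []" "\<tau> \<noteq> []"
      "hd \<tau> = f (hd xs)"
    show "\<phi> (f x # \<tau>) = \<psi> (f x # \<tau>)"
      using \<tau> Cons.prems(2,3) by (intro Cons.prems(1)) (auto simp: successively_Cons)
  qed (use Cons.prems in \<open>auto simp: successively_Cons\<close>)
  ultimately show ?case by simp
qed simp

text \<open>Transpose of \<open>z \<mapsto> (z + a z) \<times> [0, M]\<close>, pushed forward along the homotopy \<open>h\<close>.\<close>

definition sweep :: "(nat \<Rightarrow> 'a \<Rightarrow> 'a) \<Rightarrow> ('a \<Rightarrow> 'a) \<Rightarrow> nat \<Rightarrow> 'a cochain \<Rightarrow> 'a cochain" where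
  "sweep h a M \<phi> \<sigma> = (\<Sum>t<M. prism (h t) (h (Suc t)) \<phi> \<sigma> + prism (h t) (h (Suc t)) \<phi> (map a \<sigma>))"

lemma sweep_add: "sweep h a M (\<lambda>\<tau>. \<phi> \<tau> + \<psi> \<tau>) = (\<lambda>\<sigma>. sweep h a M \<phi> \<sigma> + sweep h a M \<psi> \<sigma>)"
proof
  fix \<sigma>
  show "sweep h a M (\<lambda>\<tau>. \<phi> \<tau> + \<psi> \<tau>) \<sigma> = sweep h a M \<phi> \<sigma> + sweep h a M \<psi> \<sigma>"
    unfolding sweep_def prism_add sum.distrib[symmetric] by (rule sum.cong) (simp_all add: ac_simps)
qed

lemma bit_telescope: "(\<Sum>t<M. \<phi> t + \<phi> (Suc t)) = \<phi> 0 + (\<phi> M :: bit)"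
  by (induction M) (simp_all add: ac_simps)

text \<open>The prism formulas of consecutive times telescope. At time \<open>M\<close> the images
  of \<open>\<sigma>\<close> and \<open>map a \<sigma>\<close> coincide and cancel, so only the end
  at time 0 survives.\<close>

lemma sweep_homotopy:
  assumes "\<And>x. h 0 x = x" "\<And>x. h M (a x) = h M x"
  shows "sweep h a M (coboundary \<phi>) \<sigma> + coboundary (sweep h a M \<phi>) \<sigma> = \<phi> \<sigma> + \<phi> (map a \<sigma>)"
proof -
  let ?P = "\<lambda>t. prism (h t) (h (Suc t))"
  have "coboundary (sweep h a M \<phi>) \<sigma> = (\<Sum>t<M. coboundary (?P t \<phi>) \<sigma> + coboundary (?P t \<phi>) (map a \<sigma>))"
    unfolding sweep_def by (simp add: coboundary_sum coboundary_add coboundary_map)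
  then have "sweep h a M (coboundary \<phi>) \<sigma> + coboundary (sweep h a M \<phi>) \<sigma> =
      (\<Sum>t<M. (?P t (coboundary \<phi>) \<sigma> + coboundary (?P t \<phi>) \<sigma>) +
              (?P t (coboundary \<phi>) (map a \<sigma>) + coboundary (?P t \<phi>) (map a \<sigma>)))"
    by (simp add: sweep_def ac_simps flip: sum.distrib)
  also have "\<dots> = (\<Sum>t<M. (\<phi> (map (h t) \<sigma>) + \<phi> (map (h t) (map a \<sigma>))) +
                         (\<phi> (map (h (Suc t)) \<sigma>) + \<phi> (map (h (Suc t)) (map a \<sigma>))))"
    by (simp only: prism_homotopy) (simp add: ac_simps)
  also have "\<dots> = (\<phi> (map (h 0) \<sigma>) + \<phi> (map (h 0) (map a \<sigma>))) + (\<phi> (map (h M) \<sigma>) + \<phi> (map (h M) (map a \<sigma>)))"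
    by (rule bit_telescope)
  also have "map (h M) (map a \<sigma>) = map (h M) \<sigma>"
    using assms(2) by simp
  finally show ?thesis
    by (simp add: assms(1))
qed

lemma sweep_invariant:
  assumes "\<And>x. a (a x) = x"
  shows "sweep h a M \<phi> (map a \<sigma>) = sweep h a M \<phi> \<sigma>"
  by (simp add: sweep_def assms ac_simps comp_def)

lemma sweep_comp:
  assumes "\<And>t x. b (h t x) = h t (b x)" "\<And>x. b (a x) = a (b x)"
  shows "sweep h a M (\<lambda>\<tau>. \<phi> (map b \<tau>)) = (\<lambda>\<sigma>. sweep h a M \<phi> (map b \<sigma>))"
  by (rule ext) (simp add: sweep_def prism_comp prism_map assms comp_def)

lemma sweep_cong:
  assumes "\<And>\<tau>. set \<tau> \<subseteq> K' \<Longrightarrow> successively R \<tau> \<Longrightarrow> \<phi> \<tau> = \<psi> \<tau>"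
    and "set \<sigma> \<subseteq> K" "successively R \<sigma>"
    and "a ` K \<subseteq> K" "\<And>t x. x \<in> K \<Longrightarrow> h t x \<in> K'"
    and "\<And>u v. R u v \<Longrightarrow> R (a u) (a v)"
    and "\<And>t u v. R u v \<Longrightarrow> R (h t u) (h t v)"
    and "\<And>t u. u \<in> K \<Longrightarrow> R (h t u) (h (Suc t) u)"
  shows "sweep h a M \<phi> \<sigma> = sweep h a M \<psi> \<sigma>"
proof -
  have *: "prism (h t) (h (Suc t)) \<phi> \<rho> = prism (h t) (h (Suc t)) \<psi> \<rho>"
    if "set \<rho> \<subseteq> K" "successively R \<rho>" for t \<rho>
  proof (rule prism_cong[where R=R and Q=R])
    fix \<tau> assume "set \<tau> \<subseteq> h t ` set \<rho> \<union> h (Suc t) ` set \<rho>" "successively R \<tau>"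
    moreover have "h t ` set \<rho> \<union> h (Suc t) ` set \<rho> \<subseteq> K'"
      using that(1) assms(5) by blast
    ultimately show "\<phi> \<tau> = \<psi> \<tau>"
      by (intro assms(1)) auto
  qed (use that assms(7,8) in auto)
  have "successively R (map a \<sigma>)"
    unfolding successively_map using assms(3) by (rule successively_mono) (rule assms(6))
  then show ?thesis
    unfolding sweep_def using assms(2-4) by (intro sum.cong refl arg_cong2[of _ _ _ _ "(+)"] *) auto
qed

text \<open>The cup product of the 1-cochains \<open>s x + s y\<close>, which detect a sign change along the edge \<open>x y\<close>.\<close>

primrec sign_changes :: "('a \<Rightarrow> bit) list \<Rightarrow> 'a cochain" where
  "sign_changes [] \<sigma> = of_bool (length \<sigma> = 1)"
| "sign_changes (s # ss) \<sigma> = (case \<sigma> of x # y # zs \<Rightarrow> (s x + s y) * sign_changes ss (y # zs) | _ \<Rightarrow> 0)"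

lemma sign_changes_Nil [simp]: "sign_changes ss [] = 0"
  by (cases ss) simp_all

lemma coboundary_eq_0: "(\<And>\<tau>. length \<tau> + 1 = length \<sigma> \<Longrightarrow> \<phi> \<tau> = 0) \<Longrightarrow> coboundary \<phi> \<sigma> = 0"
  by (induction \<sigma> arbitrary: \<phi>) simp_all

text \<open>Leibniz rule for cup products of cocycles: in the inductive step, the sign changes along
  the three edges of the first triangle add up to zero.\<close>

lemma sign_changes_cocycle: "coboundary (sign_changes ss) \<sigma> = 0"
proof (induction ss arbitrary: \<sigma>)
  case Nil
  consider "length \<sigma> \<noteq> 2" | x y where "\<sigma> = [x, y]"
    by (auto simp: numeral_2_eq_2 length_Suc_conv)
  then show ?case
    by cases (auto intro!: coboundary_eq_0)
next
  case (Cons s ss)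
  consider "\<sigma> = []" | x where "\<sigma> = [x]" | x y where "\<sigma> = [x, y]"
    | x y z r where "\<sigma> = x # y # z # r"
    by (metis list.exhaust)
  then show ?case
  proof cases
    case (4 x y z r)
    have "sign_changes ss (z # r) + coboundary (\<lambda>\<tau>. sign_changes ss (y # \<tau>)) (z # r) = 0"
      using Cons[of "y # z # r"] by simp
    then have "coboundary (\<lambda>\<tau>. sign_changes ss (y # \<tau>)) (z # r) = sign_changes ss (z # r)"
      by (metis add.commute add.left_neutral bit_add_cancel(2))
    then have "coboundary (sign_changes (s # ss)) \<sigma> = (s y + s z) * sign_changes ss (z # r) +
        ((s x + s z) * sign_changes ss (z # r) + (s x + s y) * sign_changes ss (z # r))"
      unfolding 4 coboundary.simps(2)[of _ x] coboundary.simps(2)[of _ y]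
      by (simp add: coboundary_cmult del: coboundary.simps(2))
    also have "\<dots> = 0"
      by (cases "s x"; cases "s y"; cases "s z"; simp)
    finally show ?thesis .
  qed simp_all
qed

text \<open>The first factor is the coboundary of the 0-cochain \<open>s\<close> and the product of
  the others is a cocycle, so the whole product is exact. Stokes' formula will be applied to this
  primitive.\<close>

lemma sign_changes_Cons:
  "sign_changes (s # ss) = coboundary (\<lambda>\<tau>. case \<tau> of [] \<Rightarrow> 0 | x # xs \<Rightarrow> s x * sign_changes ss \<tau>)"
proof
  fix \<sigma> :: "'a list"
  consider "\<sigma> = []" | x where "\<sigma> = [x]" | x y r where "\<sigma> = x # y # r"
    by (metis list.exhaust)
  then show "sign_changes (s # ss) \<sigma> = coboundary (\<lambda>\<tau>. case \<tau> of [] \<Rightarrow> 0 | x # xs \<Rightarrow> s x * sign_changes ss \<tau>) \<sigma>"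
  proof cases
    case (3 x y r)
    have "sign_changes ss (y # r) + coboundary (\<lambda>\<tau>. sign_changes ss (x # \<tau>)) (y # r) = 0"
      using sign_changes_cocycle[of ss "x # y # r"] by simp
    then have "coboundary (\<lambda>\<tau>. sign_changes ss (x # \<tau>)) (y # r) = sign_changes ss (y # r)"
      by (metis add.commute add.left_neutral bit_add_cancel(2))
    then show ?thesis
      unfolding 3 by (subst coboundary.simps(2)) (simp add: coboundary_cmult algebra_simps del: coboundary.simps(2))
  qed simp_all
qed

section \<open>Chains on products of spheres\<close>

type_synonym point = "nat \<Rightarrow> nat \<Rightarrow> real"

definition antip :: "nat \<Rightarrow> point \<Rightarrow> point" where
  "antip i x = x(i := \<lambda>j. - x i j)"

text \<open>Meant for unit vectors \<open>x i\<close> orthogonal to the pole with index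
  \<open>n\<close>: the point travels a quarter of a great circle, from \<open>x i\<close> at angle
  0 to the pole at \<open>pi / 2\<close>, where antipodal starting points meet.\<close>

definition tilt :: "nat \<Rightarrow> nat \<Rightarrow> real \<Rightarrow> point \<Rightarrow> point" where
  "tilt i n \<theta> x = x(i := \<lambda>j. cos \<theta> * x i j + (if j = n then sin \<theta> else 0))"

lemma antip_antip [simp]: "antip i (antip i x) = x"
  by (simp add: antip_def)

lemma antip_commute: "antip i (antip j x) = antip j (antip i x)"
  by (cases "i = j") (auto simp: antip_def fun_eq_iff)

lemma antip_tilt: "i \<noteq> j \<Longrightarrow> antip i (tilt j n \<theta> x) = tilt j n \<theta> (antip i x)"
  by (auto simp: antip_def tilt_def fun_eq_iff)

text \<open>Transpose of \<open>z \<mapsto> z \<times> e\<close>, where \<open>e\<close> is the fundamental chain of a hemisphere of dimension \<open>n\<close>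
  in block \<open>i\<close>. A hemisphere arises by tilting the two hemispheres of its equator towards the pole;
  over the pole the two halves degenerate to equal tuples, which cancel mod 2.\<close>

primrec hemisphere :: "nat \<Rightarrow> nat \<Rightarrow> nat \<Rightarrow> point cochain \<Rightarrow> point cochain" where
  "hemisphere M i 0 \<phi> = \<phi>"
| "hemisphere M i (Suc n) \<phi> =
     hemisphere M i n (sweep (\<lambda>t. tilt i (Suc n) (pi / 2 * (real t / real M))) (antip i) M \<phi>)"

lemma hemisphere_add: "hemisphere M i n (\<lambda>\<tau>. \<phi> \<tau> + \<psi> \<tau>) \<sigma> = hemisphere M i n \<phi> \<sigma> + hemisphere M i n \<psi> \<sigma>"
  by (induction n arbitrary: \<phi> \<psi>) (simp_all add: sweep_add)

lemma hemisphere_zero: "hemisphere M i n (\<lambda>\<tau>. 0) \<sigma> = 0"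
  using hemisphere_add[of M i n "\<lambda>\<tau>. 0" "\<lambda>\<tau>. 0" \<sigma>] by simp

lemma hemisphere_antip:
  assumes "i \<noteq> l"
  shows "hemisphere M i n (\<lambda>\<tau>. \<phi> (map (antip l) \<tau>)) \<sigma> = hemisphere M i n \<phi> (map (antip l) \<sigma>)"
proof (induction n arbitrary: \<phi>)
  case (Suc n)
  have "sweep (\<lambda>t. tilt i (Suc n) (pi / 2 * (real t / real M))) (antip i) M (\<lambda>\<tau>. \<phi> (map (antip l) \<tau>)) =
     (\<lambda>\<tau>. sweep (\<lambda>t. tilt i (Suc n) (pi / 2 * (real t / real M))) (antip i) M \<phi> (map (antip l) \<tau>))"
    using assms by (intro sweep_comp) (auto simp: antip_tilt antip_commute)
  then show ?case
    by (simp only: hemisphere.simps Suc)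
qed simp

definition flip_sum :: "nat \<Rightarrow> point cochain \<Rightarrow> point cochain" where
  "flip_sum i \<phi> \<sigma> = \<phi> \<sigma> + \<phi> (map (antip i) \<sigma>)"

lemma hemisphere_flip_sum: "i \<noteq> l \<Longrightarrow> hemisphere M i n (flip_sum l \<phi>) = flip_sum l (hemisphere M i n \<phi>)"
  unfolding flip_sum_def fun_eq_iff by (simp add: hemisphere_add hemisphere_antip)

lemma bit_add_eq_iff: "a + b = c \<longleftrightarrow> a = b + (c :: bit)"
  by (cases a; cases b; cases c) (simp_all add: add_bit_eq_xor)

text \<open>Stokes' formula for one hemisphere: its boundary consists of two antipodal hemispheres
  of dimension \<open>n - 1\<close>, which \<open>flip_sum\<close> encodes on the cochain
  side.\<close>

lemma hemisphere_coboundary: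
  assumes "M > 0"
  shows "hemisphere M i n (coboundary \<phi>) \<sigma> =
    coboundary (hemisphere M i n \<phi>) \<sigma> + (if n = 0 then 0 else hemisphere M i (n - 1) (flip_sum i \<phi>) \<sigma>)"
proof (induction n arbitrary: \<phi> \<sigma>)
  case (Suc n)
  let ?h = "\<lambda>t. tilt i (Suc n) (pi / 2 * (real t / real M))"
  let ?T = "sweep ?h (antip i) M"
  have 1: "?T (coboundary \<phi>) = (\<lambda>\<tau>. coboundary (?T \<phi>) \<tau> + flip_sum i \<phi> \<tau>)"
  proof
    fix \<tau>
    have "?T (coboundary \<phi>) \<tau> + coboundary (?T \<phi>) \<tau> = \<phi> \<tau> + \<phi> (map (antip i) \<tau>)"
      by (rule sweep_homotopy) (use assms in \<open>auto simp: tilt_def antip_def fun_eq_iff\<close>)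
    then show "?T (coboundary \<phi>) \<tau> = coboundary (?T \<phi>) \<tau> + flip_sum i \<phi> \<tau>"
      by (simp add: bit_add_eq_iff flip_sum_def)
  qed
  \<comment> \<open>The sweep is already symmetric under \<open>antip i\<close>, so the term that
    the induction hypothesis attaches to the boundary of the equatorial hemisphere is counted twice
    and cancels.\<close>
  have 2: "flip_sum i (?T \<phi>) = (\<lambda>\<tau>. 0)"
    by (simp add: flip_sum_def fun_eq_iff sweep_invariant)
  show ?case
    using Suc[of "?T \<phi>"] by (simp add: 1 2 hemisphere_add Suc hemisphere_zero del: times_divide_eq_right times_divide_eq_left times_divide_times_eq)
qed simp

primrec hemisphere_product :: "nat \<Rightarrow> nat \<Rightarrow> (nat \<Rightarrow> nat) \<Rightarrow> point cochain \<Rightarrow> point cochain" where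
  "hemisphere_product M 0 n \<phi> = \<phi>"
| "hemisphere_product M (Suc b) n \<phi> = hemisphere_product M b n (hemisphere M b (n b) \<phi>)"

lemma hemisphere_product_add: "hemisphere_product M b n (\<lambda>\<tau>. \<phi> \<tau> + \<psi> \<tau>) \<sigma> = hemisphere_product M b n \<phi> \<sigma> + hemisphere_product M b n \<psi> \<sigma>"
proof (induction b arbitrary: \<phi> \<psi>)
  case (Suc b)
  have "hemisphere M b (n b) (\<lambda>\<tau>. \<phi> \<tau> + \<psi> \<tau>) = (\<lambda>\<tau>. hemisphere M b (n b) \<phi> \<tau> + hemisphere M b (n b) \<psi> \<tau>)"
    by (simp add: hemisphere_add fun_eq_iff)
  with Suc show ?case by simp
qed simp

lemma hemisphere_product_zero: "hemisphere_product M b n (\<lambda>\<tau>. 0) \<sigma> = 0"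
  using hemisphere_product_add[of M b n "\<lambda>\<tau>. 0" "\<lambda>\<tau>. 0" \<sigma>] by simp

lemma hemisphere_product_cong: "(\<And>i. i < b \<Longrightarrow> n i = n' i) \<Longrightarrow> hemisphere_product M b n \<phi> = hemisphere_product M b n' \<phi>"
  by (induction b arbitrary: \<phi>) simp_all

text \<open>Product rule: the boundary acts on one factor at a time. The last block is handled by
  \<open>hemisphere_coboundary\<close>, the others by induction, since \<open>flip_sum i\<close>
  commutes with the hemisphere operator of a different block.\<close>

lemma hemisphere_product_coboundary:
  assumes "M > 0"
  shows "hemisphere_product M b n (coboundary \<phi>) \<sigma> = coboundary (hemisphere_product M b n \<phi>) \<sigma> +
    (\<Sum>i<b. if n i = 0 then 0 else hemisphere_product M b (n(i := n i - 1)) (flip_sum i \<phi>) \<sigma>)"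
proof (induction b arbitrary: \<phi> \<sigma>)
  case (Suc b)
  let ?r = "if n b = 0 then 0 else hemisphere_product M (Suc b) (n(b := n b - 1)) (flip_sum b \<phi>) \<sigma>"
  have *: "hemisphere_product M b (n(b := k)) = hemisphere_product M b n" for k
    by (rule ext) (rule hemisphere_product_cong, simp)
  have "hemisphere_product M (Suc b) n (coboundary \<phi>) \<sigma> = hemisphere_product M b n (coboundary (hemisphere M b (n b) \<phi>)) \<sigma> + ?r"
  proof (cases "n b")
    case 0
    then show ?thesis by simp
  next
    case (Suc k)
    have "hemisphere M b (n b) (coboundary \<phi>) =
        (\<lambda>\<tau>. coboundary (hemisphere M b (n b) \<phi>) \<tau> + hemisphere M b k (flip_sum b \<phi>) \<tau>)"
      using hemisphere_coboundary[OF assms, of b "n b" \<phi>] Suc by (simp add: fun_eq_iff del: hemisphere.simps)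
    then show ?thesis
      by (simp add: hemisphere_product_add Suc * del: hemisphere.simps)
  qed
  also have "hemisphere_product M b n (coboundary (hemisphere M b (n b) \<phi>)) \<sigma> = coboundary (hemisphere_product M (Suc b) n \<phi>) \<sigma> +
    (\<Sum>i<b. if n i = 0 then 0 else hemisphere_product M (Suc b) (n(i := n i - 1)) (flip_sum i \<phi>) \<sigma>)"
    unfolding Suc.IH by (auto intro!: sum.cong simp: hemisphere_flip_sum)
  finally show ?case
    by (simp add: add.assoc)
qed simp

section \<open>Support and mesh of the hemisphere chains\<close>

definition spheres :: "nat \<Rightarrow> (nat \<Rightarrow> nat) \<Rightarrow> point set" where
  "spheres b n = {x. (\<forall>i<b. (\<forall>j>n i. x i j = 0) \<and> (\<Sum>j\<le>n i. (x i j)\<^sup>2) = 1) \<and> (\<forall>i\<ge>b. \<forall>j. x i j = 0)}"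

definition near :: "real \<Rightarrow> point \<Rightarrow> point \<Rightarrow> bool" where
  "near \<epsilon> x y \<longleftrightarrow> (\<forall>i j. \<bar>x i j - y i j\<bar> \<le> \<epsilon>)"

lemma spheres_le_1:
  assumes "x \<in> spheres b n"
  shows "\<bar>x i j\<bar> \<le> 1"
proof (cases "i < b \<and> j \<le> n i")
  case True
  then have "(x i j)\<^sup>2 \<le> (\<Sum>j\<le>n i. (x i j)\<^sup>2)"
    by (intro member_le_sum) auto
  with True assms show ?thesis
    by (simp add: spheres_def abs_square_le_1)
next
  case False
  with assms have "x i j = 0"
    by (cases "i < b") (auto simp: spheres_def)
  then show ?thesis by simp
qed

lemma antip_spheres: "x \<in> spheres b n \<Longrightarrow> antip i x \<in> spheres b n"
  by (auto simp: spheres_def antip_def)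

lemma tilt_spheres:
  assumes "x \<in> spheres b (n(i := k))" "i < b"
  shows "tilt i (Suc k) \<theta> x \<in> spheres b (n(i := Suc k))"
proof -
  have x: "\<forall>j>k. x i j = 0" "(\<Sum>j\<le>k. (x i j)\<^sup>2) = 1"
    using assms unfolding spheres_def by (auto dest: spec[of _ i])
  have "(\<Sum>j\<le>Suc k. (tilt i (Suc k) \<theta> x i j)\<^sup>2) = (\<Sum>j\<le>k. (cos \<theta>)\<^sup>2 * (x i j)\<^sup>2) + (sin \<theta>)\<^sup>2"
    using x(1) by (simp add: tilt_def power_mult_distrib)
  also have "\<dots> = 1"
    using x(2) by (simp flip: sum_distrib_left)
  finally show ?thesis
    using assms x(1) by (auto simp: spheres_def tilt_def)
qed

lemma near_antip: "near \<epsilon> x y \<Longrightarrow> near \<epsilon> (antip i x) (antip i y)"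
  unfolding near_def antip_def by (auto simp: abs_minus_commute)

lemma near_tilt:
  assumes "near \<epsilon> x y"
  shows "near \<epsilon> (tilt i n \<theta> x) (tilt i n \<theta> y)"
proof -
  have "\<bar>cos \<theta> * x i j - cos \<theta> * y i j\<bar> \<le> \<epsilon>" for j
  proof -
    have "\<bar>cos \<theta> * x i j - cos \<theta> * y i j\<bar> = \<bar>cos \<theta>\<bar> * \<bar>x i j - y i j\<bar>"
      by (simp add: abs_mult flip: right_diff_distrib)
    also have "\<dots> \<le> 1 * \<bar>x i j - y i j\<bar>"
      by (intro mult_right_mono) auto
    also have "\<dots> \<le> \<epsilon>"
      using assms by (simp add: near_def)
    finally show ?thesis .
  qed
  with assms show ?thesis
    by (auto simp: near_def tilt_def)
qed

lemma abs_cos_sin_diff_le: "\<bar>cos a - cos b\<bar> \<le> \<bar>a - b\<bar>" "\<bar>sin a - sin b\<bar> \<le> \<bar>a - (b::real)\<bar>"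
proof -
  show "\<bar>cos a - cos b\<bar> \<le> \<bar>a - b\<bar>"
    using field_differentiable_bound[of UNIV cos "\<lambda>x. - sin x" 1 a b]
    by (auto intro!: derivative_eq_intros simp: abs_sin_le_one)
  show "\<bar>sin a - sin b\<bar> \<le> \<bar>a - b\<bar>"
    using field_differentiable_bound[of UNIV sin cos 1 a b]
    by (auto intro!: derivative_eq_intros)
qed

text \<open>The factor 2 arises because a coordinate may change through both the cosine and the sine
  term. Time steps of \<open>pi / (2 * M)\<close> therefore give mesh \<open>pi / M\<close>.\<close>

lemma near_tilt_tilt:
  assumes "x \<in> spheres b n" "2 * \<bar>\<theta> - \<eta>\<bar> \<le> \<epsilon>"
  shows "near \<epsilon> (tilt i k \<theta> x) (tilt i k \<eta> x)"
  unfolding near_def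
proof (intro allI)
  fix i' j
  have "\<bar>cos \<theta> - cos \<eta>\<bar> * \<bar>x i j\<bar> \<le> \<bar>\<theta> - \<eta>\<bar> * 1"
    using spheres_le_1[OF assms(1)] abs_cos_sin_diff_le by (intro mult_mono) auto
  then have cos_le: "\<bar>cos \<theta> * x i j - cos \<eta> * x i j\<bar> \<le> \<bar>\<theta> - \<eta>\<bar>"
    by (simp add: abs_mult flip: left_diff_distrib)
  have "tilt i k \<theta> x i' j - tilt i k \<eta> x i' j =
      (if i' = i then cos \<theta> * x i j - cos \<eta> * x i j + (if j = k then sin \<theta> - sin \<eta> else 0) else 0)"
    by (simp add: tilt_def)
  then have "\<bar>tilt i k \<theta> x i' j - tilt i k \<eta> x i' j\<bar> \<le>
      \<bar>cos \<theta> * x i j - cos \<eta> * x i j\<bar> + \<bar>sin \<theta> - sin \<eta>\<bar>"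
    by (auto simp: abs_triangle_ineq)
  also have "\<dots> \<le> \<bar>\<theta> - \<eta>\<bar> + \<bar>\<theta> - \<eta>\<bar>"
    using cos_le abs_cos_sin_diff_le(2) by (rule add_mono)
  finally show "\<bar>tilt i k \<theta> x i' j - tilt i k \<eta> x i' j\<bar> \<le> \<epsilon>"
    using assms(2) by simp
qed

text \<open>Each sweep raises the dimension in block \<open>i\<close> by one, does not increase
  distances within a slice, and moves a vertex by at most \<open>pi / M\<close> per time step. Hence
  only fine tuples on the product of spheres are ever evaluated.\<close>

lemma hemisphere_cong:
  assumes "M > 0" "i < b"
    and "\<And>\<tau>. set \<tau> \<subseteq> spheres b (n(i := k)) \<Longrightarrow> successively (near (pi / M)) \<tau> \<Longrightarrow> \<phi> \<tau> = \<psi> \<tau>"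
    and "set \<sigma> \<subseteq> spheres b (n(i := 0))" "successively (near (pi / M)) \<sigma>"
  shows "hemisphere M i k \<phi> \<sigma> = hemisphere M i k \<psi> \<sigma>"
  using assms(3)
proof (induction k arbitrary: \<phi> \<psi>)
  case 0
  then show ?case using assms(4,5) by (simp del: fun_upd_apply)
next
  case (Suc k)
  let ?h = "\<lambda>t. tilt i (Suc k) (pi / 2 * (real t / real M))"
  have *: "sweep ?h (antip i) M \<phi> \<tau> = sweep ?h (antip i) M \<psi> \<tau>"
    if "set \<tau> \<subseteq> spheres b (n(i := k))" "successively (near (pi / M)) \<tau>" for \<tau>
  proof (rule sweep_cong[OF Suc.prems that])
    fix t u assume "u \<in> spheres b (n(i := k))"
    then show "near (pi / M) (?h t u) (?h (Suc t) u)"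
    proof (rule near_tilt_tilt)
      have "pi / 2 * (real t / real M) - pi / 2 * (real (Suc t) / real M) = - (pi / (2 * real M))"
        using assms(1) by (simp add: field_simps)
      then show "2 * \<bar>pi / 2 * (real t / real M) - pi / 2 * (real (Suc t) / real M)\<bar> \<le> pi / real M"
        by simp
    qed
  qed (use assms(2) in \<open>auto simp: antip_spheres tilt_spheres near_antip near_tilt simp del: fun_upd_apply\<close>)
  show ?case
    unfolding hemisphere.simps by (intro Suc.IH *)
qed

text \<open>A product of zero-dimensional hemispheres: the single vertex from which the chain is
  built.\<close>

definition base_point :: "nat \<Rightarrow> point" where
  "base_point b = (\<lambda>i j. of_bool (i < b \<and> j = 0))"

lemma hemisphere_product_cong_spheres:
  assumes "M > 0" "m \<le> b"
    and "\<And>\<tau>. set \<tau> \<subseteq> spheres b (\<lambda>i. if i < m then n i else 0) \<Longrightarrow> successively (near (pi / M)) \<tau>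
          \<Longrightarrow> \<phi> \<tau> = \<psi> \<tau>"
  shows "hemisphere_product M m n \<phi> [base_point b] = hemisphere_product M m n \<psi> [base_point b]"
  using assms(2,3)
proof (induction m arbitrary: \<phi> \<psi>)
  case 0
  have "base_point b \<in> spheres b (\<lambda>i. 0)"
    by (auto simp: spheres_def base_point_def)
  with 0 show ?case by simp
next
  case (Suc m)
  let ?n = "\<lambda>i. if i < m then n i else 0"
  have "hemisphere M m (n m) \<phi> \<tau> = hemisphere M m (n m) \<psi> \<tau>"
    if \<tau>: "set \<tau> \<subseteq> spheres b ?n" "successively (near (pi / M)) \<tau>" for \<tau>
  proof (rule hemisphere_cong[OF assms(1), where n="?n"])
    have "?n(m := n m) = (\<lambda>i. if i < Suc m then n i else 0)" "?n(m := 0) = ?n"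
      by (auto simp: fun_eq_iff less_Suc_eq)
    with \<tau> Suc.prems(2) show "set \<tau> \<subseteq> spheres b (?n(m := 0))"
      and "\<And>\<rho>. set \<rho> \<subseteq> spheres b (?n(m := n m)) \<Longrightarrow> successively (near (pi / M)) \<rho> \<Longrightarrow> \<phi> \<rho> = \<psi> \<rho>"
      by auto
  qed (use Suc.prems \<tau> in auto)
  then show ?case
    unfolding hemisphere_product.simps using Suc.prems(1) by (intro Suc.IH) auto
qed

section \<open>Counting sign changes\<close>

text \<open>The coefficient of \<open>\<Prod>i. t i ^ n i\<close> in \<open>\<Prod>A\<leftarrow>As. \<Sum>i\<in>A. t i\<close> over the field with two elements,
  provided that the degrees agree.\<close>

primrec top_coeff :: "(nat \<Rightarrow> nat) \<Rightarrow> nat set list \<Rightarrow> bit" where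
  "top_coeff n [] = 1"
| "top_coeff n (A # As) = (\<Sum>i\<in>A. if n i = 0 then 0 else top_coeff (n(i := n i - 1)) As)"

lemma sum_fun_upd_decr:
  fixes n :: "nat \<Rightarrow> nat"
  assumes "finite S" "i \<in> S" "n i \<noteq> 0"
  shows "Suc (sum (n(i := n i - 1)) S) = sum n S"
  using assms by (simp add: sum.remove[OF assms(1,2)])

text \<open>Pigeonhole on degrees: the factors with \<open>A \<subseteq> {..k}\<close> involve only
  the variables up to \<open>k\<close>, and there are more of them than the exponents of these
  variables can absorb.\<close>

lemma top_coeff_eq_0:
  assumes "(\<Sum>j\<le>k. n j) < length (filter (\<lambda>A. A \<subseteq> {..k}) As)"
  shows "top_coeff n As = 0"
  using assms
proof (induction As arbitrary: n)
  case (Cons A As)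
  have "top_coeff (n(i := n i - 1)) As = 0" if "i \<in> A" "n i \<noteq> 0" for i
  proof (rule Cons.IH)
    show "sum (n(i := n i - 1)) {..k} < length (filter (\<lambda>A. A \<subseteq> {..k}) As)"
    proof (cases "A \<subseteq> {..k}")
      case True
      with that have "Suc (sum (n(i := n i - 1)) {..k}) = sum n {..k}"
        by (intro sum_fun_upd_decr) auto
      with Cons.prems True show ?thesis by simp
    next
      case False
      have "sum (n(i := n i - 1)) {..k} \<le> sum n {..k}"
        by (rule sum_mono) simp
      with Cons.prems False show ?thesis by simp
    qed
  qed
  then show ?case by (auto intro!: sum.neutral)
qed simp

text \<open>Expand the first factor. Choosing a variable \<open>j < i\<close> uses up a degree that
  the later factors supported in \<open>{..j}\<close> need, so \<open>top_coeff_eq_0\<close> kills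
  that term; only the choice of \<open>i\<close> survives.\<close>

lemma top_coeff_triangular:
  assumes "sorted_wrt (\<ge>) (map fst ps)" "\<forall>(i, A) \<in> set ps. i \<in> A \<and> A \<subseteq> {..i}"
  shows "top_coeff (count_list (map fst ps)) (map snd ps) = 1"
  using assms
proof (induction ps)
  case (Cons p ps)
  obtain i A where p: "p = (i, A)" by force
  define N where "N = count_list (map fst (p # ps))"
  let ?n = "count_list (map fst ps)"
  have N: "N = ?n(i := Suc (?n i))"
    by (auto simp: p N_def fun_eq_iff)
  have A: "i \<in> A" "A \<subseteq> {..i}" "finite A"
    using Cons.prems p finite_subset by auto
  have zero: "top_coeff (N(j := N j - 1)) (map snd ps) = 0" if "j \<in> A" "j \<noteq> i" "N j \<noteq> 0" for j
  proof (rule top_coeff_eq_0[where k=j])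
    have "j < i" using that A by auto
    have "Suc (sum (N(j := N j - 1)) {..j}) = sum N {..j}"
      using that by (intro sum_fun_upd_decr) auto
    also have "sum N {..j} = sum ?n {..j}"
      using \<open>j < i\<close> by (intro sum.cong) (auto simp: p N_def)
    also have "\<dots> = length (filter (\<lambda>q. fst q \<le> j) ps)"
    proof (induction ps)
      case (Cons q ps)
      have "sum (count_list (map fst (q # ps))) {..j} =
          (\<Sum>i\<le>j. count_list (map fst ps) i + of_bool (fst q = i))"
        by (intro sum.cong) auto
      with Cons show ?case
        by (simp add: sum.distrib of_bool_def)
    qed simp
    also have "\<dots> \<le> length (filter (\<lambda>q. snd q \<subseteq> {..j}) ps)"
    proof -
      have "snd q \<subseteq> {..j}" if "q \<in> set ps" "fst q \<le> j" for q
      proof -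
        have "snd q \<subseteq> {..fst q}"
          using Cons.prems(2) that(1) by (cases q) auto
        with that(2) show ?thesis by auto
      qed
      then show ?thesis by (induction ps) auto
    qed
    finally show "sum (N(j := N j - 1)) {..j} < length (filter (\<lambda>A. A \<subseteq> {..j}) (map snd ps))"
      by (simp add: filter_map comp_def)
  qed
  have "top_coeff N (map snd (p # ps)) =
      (\<Sum>j\<in>A. if N j = 0 then 0 else top_coeff (N(j := N j - 1)) (map snd ps))"
    by (simp add: p)
  also have "\<dots> = top_coeff (N(i := N i - 1)) (map snd ps) +
      (\<Sum>j\<in>A - {i}. if N j = 0 then 0 else top_coeff (N(j := N j - 1)) (map snd ps))"
    by (subst sum.remove[OF A(3,1)]) (simp add: N)
  also have "(\<Sum>j\<in>A - {i}. if N j = 0 then 0 else top_coeff (N(j := N j - 1)) (map snd ps)) = 0"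
    using zero by (intro sum.neutral ballI) (simp del: fun_upd_apply)
  also have "N(i := N i - 1) = ?n"
    by (simp add: N)
  also have "top_coeff ?n (map snd ps) = 1"
    using Cons by auto
  finally show ?case
    by (simp add: N_def)
qed simp

text \<open>The set \<open>A\<close> stands for the linear form \<open>\<Sum>i\<in>A. t i\<close> of
  \<open>top_coeff\<close>: the class of the sign cochain of \<open>s\<close>.\<close>

definition has_parity_on :: "point set \<Rightarrow> nat \<Rightarrow> nat set \<Rightarrow> (point \<Rightarrow> bit) \<Rightarrow> bool" where
  "has_parity_on K b A s \<longleftrightarrow> (\<forall>x\<in>K. \<forall>i<b. s (antip i x) = s x + of_bool (i \<in> A))"

lemma has_parity_onD: "has_parity_on K b A s \<Longrightarrow> x \<in> K \<Longrightarrow> i < b \<Longrightarrow> s (antip i x) = s x + of_bool (i \<in> A)"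
  by (simp add: has_parity_on_def)

lemma spheres_mono:
  assumes "x \<in> spheres b n" "\<And>i. i < b \<Longrightarrow> n i \<le> n' i"
  shows "x \<in> spheres b n'"
proof -
  have "(\<Sum>j\<le>n' i. (x i j)\<^sup>2) = (\<Sum>j\<le>n i. (x i j)\<^sup>2)" if "i < b" for i
    using assms that by (intro sum.mono_neutral_right) (auto simp: spheres_def)
  moreover have "\<forall>j>n' i. x i j = 0" if "i < b" for i
    using assms that by (force simp: spheres_def)
  ultimately show ?thesis
    using assms by (simp add: spheres_def)
qed

lemma sign_changes_antip:
  assumes "\<And>s. s \<in> set ss \<Longrightarrow> \<exists>A. has_parity_on K b A s" "set \<sigma> \<subseteq> K" "i < b"
  shows "sign_changes ss (map (antip i) \<sigma>) = sign_changes ss \<sigma>"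
  using assms(1,2)
proof (induction ss arbitrary: \<sigma>)
  case (Cons s ss)
  obtain A where A: "has_parity_on K b A s"
    using Cons.prems(1) by auto
  have "s (antip i x) + s (antip i y) = s x + s y" if "x \<in> K" "y \<in> K" for x y
    using that assms(3) A by (simp add: has_parity_onD ac_simps)
  moreover have "sign_changes ss (map (antip i) \<tau>) = sign_changes ss \<tau>" if "set \<tau> \<subseteq> K" for \<tau>
    using Cons.prems(1) that by (intro Cons.IH) auto
  from this[of "tl \<sigma>"] have "sign_changes ss (map (antip i) (tl \<sigma>)) = sign_changes ss (tl \<sigma>)"
    using Cons.prems(2) by (cases \<sigma>) auto
  ultimately show ?case
    using Cons.prems(2) by (auto split: list.split)
qed simp

text \<open>Stokes' formula applied to the primitive of \<open>sign_changes_Cons\<close> reduces the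
  count to the faces of the product of hemispheres, and the resulting recursion is that of
  \<open>top_coeff\<close>. When all dimensions are 0 the chain is one vertex, which counts
  1.\<close>

lemma hemisphere_product_sign_changes:
  assumes "M > 0" "length As = length ss" "(\<Sum>i<b. n i) = length ss"
    and "\<And>l. l < length ss \<Longrightarrow> As ! l \<subseteq> {..<b} \<and> has_parity_on (spheres b n) b (As ! l) (ss ! l)"
  shows "hemisphere_product M b n (sign_changes ss) [base_point b] = top_coeff n As"
  using assms(2-4)
proof (induction ss arbitrary: As n)
  case Nil
  then have n: "n i = 0" if "i < b" for i
    using that by simp
  have "hemisphere_product M m n \<phi> = \<phi>" if "m \<le> b" for m \<phi>
    using that n by (induction m arbitrary: \<phi>) simp_all
  with Nil show ?case by simp
next
  case (Cons s ss)
  then obtain A As' where As: "As = A # As'"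
    by (cases As) auto
  have A: "A \<subseteq> {..<b}" "has_parity_on (spheres b n) b A s"
    using Cons.prems(3)[of 0] As by auto
  have ss: "As' ! l \<subseteq> {..<b} \<and> has_parity_on (spheres b n) b (As' ! l) (ss ! l)" if "l < length ss" for l
    using Cons.prems(3)[of "Suc l"] As that by auto
  define \<phi> where "\<phi> = (\<lambda>\<tau>. case \<tau> of [] \<Rightarrow> 0 | x # xs \<Rightarrow> s x * sign_changes ss \<tau>)"
  \<comment> \<open>On a single vertex the coboundary is the value at the empty tuple; this
    augmentation term has to vanish.\<close>
  have hemisphere_Nil: "hemisphere M i k \<psi> [] = 0" if "\<psi> [] = 0" for i k \<psi>
    using that by (induction k arbitrary: \<psi>) (simp_all add: sweep_def)
  have hemisphere_product_Nil: "hemisphere_product M m n \<psi> [] = 0" if "\<psi> [] = 0" for m \<psi>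
    using that by (induction m arbitrary: \<psi>) (simp_all add: hemisphere_Nil)
  \<comment> \<open>On two antipodal copies the remaining factors agree, while \<open>s\<close>
    differs by \<open>of_bool (i \<in> A)\<close>. The face in block \<open>i\<close> thus
    contributes the remaining count if \<open>i \<in> A\<close> and nothing otherwise.\<close>
  have face: "(if n i = 0 then 0 else hemisphere_product M b (n(i := n i - 1)) (flip_sum i \<phi>) [base_point b]) =
      (if i \<in> A then if n i = 0 then 0 else top_coeff (n(i := n i - 1)) As' else 0)" if "i < b" for i
  proof (cases "n i = 0")
    case False
    let ?n = "n(i := n i - 1)"
    have sub: "spheres b ?n \<subseteq> spheres b n"
      by (auto elim!: spheres_mono split: if_splits)
    have "hemisphere_product M b ?n (flip_sum i \<phi>) [base_point b] =
        hemisphere_product M b ?n (\<lambda>\<tau>. if i \<in> A then sign_changes ss \<tau> else 0) [base_point b]"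
    proof (rule hemisphere_product_cong_spheres[OF assms(1) order.refl])
      fix \<tau> assume "set \<tau> \<subseteq> spheres b (\<lambda>j. if j < b then ?n j else 0)"
      also have "\<dots> \<subseteq> spheres b n"
        by (rule subsetI, erule spheres_mono) auto
      finally have \<tau>: "set \<tau> \<subseteq> spheres b n" .
      have "sign_changes ss (map (antip i) \<tau>) = sign_changes ss \<tau>"
      proof (rule sign_changes_antip[OF _ \<tau> that])
        fix s' assume "s' \<in> set ss"
        then show "\<exists>A. has_parity_on (spheres b n) b A s'"
          using ss by (metis in_set_conv_nth)
      qed
      with \<tau> A(2) that show "flip_sum i \<phi> \<tau> = (if i \<in> A then sign_changes ss \<tau> else 0)"
        by (cases \<tau>) (auto simp: flip_sum_def \<phi>_def has_parity_onD distrib_right)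
    qed
    also have "\<dots> = (if i \<in> A then hemisphere_product M b ?n (sign_changes ss) [base_point b] else 0)"
      by (simp add: hemisphere_product_zero)
    also have "hemisphere_product M b ?n (sign_changes ss) [base_point b] = top_coeff ?n As'"
    proof (rule Cons.IH)
      show "length As' = length ss" using Cons.prems As by simp
      show "sum ?n {..<b} = length ss"
        using sum_fun_upd_decr[of "{..<b}" i n] that False Cons.prems(2) by simp
      show "As' ! l \<subseteq> {..<b} \<and> has_parity_on (spheres b ?n) b (As' ! l) (ss ! l)" if "l < length ss" for l
        using ss[OF that] sub by (auto simp: has_parity_on_def)
    qed
    finally show ?thesis using False by (simp del: fun_upd_apply)
  qed simp
  have "hemisphere_product M b n (sign_changes (s # ss)) [base_point b] =
      (\<Sum>i<b. if n i = 0 then 0 else hemisphere_product M b (n(i := n i - 1)) (flip_sum i \<phi>) [base_point b])"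
    unfolding sign_changes_Cons \<phi>_def[symmetric] hemisphere_product_coboundary[OF assms(1)]
    using hemisphere_product_Nil by (simp add: \<phi>_def)
  also have "\<dots> = (\<Sum>i<b. if i \<in> A then if n i = 0 then 0 else top_coeff (n(i := n i - 1)) As' else 0)"
    by (rule sum.cong) (simp_all add: face)
  also have "\<dots> = top_coeff n As"
    using A(1) unfolding As top_coeff.simps by (simp add: sum.If_cases Int_absorb1)
  finally show ?case .
qed

lemma sign_changes_nonzero:
  assumes "sign_changes ss \<sigma> \<noteq> 0"
  shows "length \<sigma> = Suc (length ss) \<and> (\<forall>l<length ss. (ss ! l) (\<sigma> ! l) \<noteq> (ss ! l) (\<sigma> ! Suc l))"
  using assms
proof (induction ss arbitrary: \<sigma>)
  case Nil
  then show ?case by (simp split: if_splits)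
next
  case (Cons s ss)
  then obtain x y zs where \<sigma>: "\<sigma> = x # y # zs"
    by (auto split: list.splits)
  with Cons.prems have "s x + s y \<noteq> 0" "sign_changes ss (y # zs) \<noteq> 0"
    by (auto simp del: bit_not_zero_iff)
  moreover from this have "s x \<noteq> s y" by auto
  ultimately show ?case
    using Cons.IH[of "y # zs"] by (auto simp: \<sigma> nth_Cons' less_Suc_eq_0_disj)
qed

text \<open>If no fine tuple had all sign changes, the cochain would agree with 0 on everything the
  chain evaluates, against its total count being 1.\<close>

lemma exists_sign_changing_tuple:
  fixes M :: nat
  assumes "M > 0" "length As = length ss" "(\<Sum>i<b. n i) = length ss" "top_coeff n As = 1"
    and "\<And>l. l < length ss \<Longrightarrow> As ! l \<subseteq> {..<b} \<and> has_parity_on (spheres b n) b (As ! l) (ss ! l)"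
  obtains \<sigma> where "set \<sigma> \<subseteq> spheres b n" "successively (near (pi / M)) \<sigma>"
    "length \<sigma> = Suc (length ss)" "\<And>l. l < length ss \<Longrightarrow> (ss ! l) (\<sigma> ! l) \<noteq> (ss ! l) (\<sigma> ! Suc l)"
proof -
  have "\<exists>\<sigma>. set \<sigma> \<subseteq> spheres b n \<and> successively (near (pi / M)) \<sigma> \<and> sign_changes ss \<sigma> \<noteq> 0"
  proof (rule ccontr)
    assume neg: "\<not> ?thesis"
    have "hemisphere_product M b n (sign_changes ss) [base_point b] = hemisphere_product M b n (\<lambda>\<tau>. 0) [base_point b]"
    proof (rule hemisphere_product_cong_spheres[OF assms(1) order.refl])
      fix \<tau> assume "set \<tau> \<subseteq> spheres b (\<lambda>i. if i < b then n i else 0)" "successively (near (pi / M)) \<tau>"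
      moreover have "spheres b (\<lambda>i. if i < b then n i else 0) \<subseteq> spheres b n"
        by (rule subsetI, erule spheres_mono) auto
      ultimately show "sign_changes ss \<tau> = 0"
        using neg by blast
    qed
    then show False
      using hemisphere_product_sign_changes[OF assms(1-3,5)] assms(4) by (simp add: hemisphere_product_zero)
  qed
  with that sign_changes_nonzero show thesis by blast
qed

section \<open>A Borsuk-Ulam theorem for products of spheres\<close>

lemma tendsto_componentwise_fun:
  fixes f :: "'c \<Rightarrow> 'a \<Rightarrow> 'b::topological_space"
  assumes "\<And>i. ((\<lambda>c. f c i) \<longlongrightarrow> l i) F"
  shows "(f \<longlongrightarrow> l) F"
proof -
  have "limitin (product_topology (\<lambda>_. euclidean) UNIV) f l F"
    using assms by (simp add: limitin_componentwise)
  then show ?thesis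
    unfolding euclidean_product_topology limitin_canonical_iff .
qed

lemma continuous_on_coordinate: "continuous_on S (\<lambda>x::point. x i j)"
  using continuous_on_id[of S]
  by (rule continuous_on_product_then_coordinatewise[THEN continuous_on_product_then_coordinatewise])

lemma closed_spheres: "closed (spheres b n)"
proof -
  have "spheres b n = (\<Inter>i\<in>{..<b}. (\<Inter>j\<in>{n i<..}. {x. x i j = 0}) \<inter> {x. (\<Sum>j\<le>n i. (x i j)\<^sup>2) = 1}) \<inter>
      (\<Inter>i\<in>{b..}. \<Inter>j. {x. x i j = 0})"
    by (auto simp: spheres_def)
  also have "closed \<dots>"
    by (intro closed_INT closed_Int ballI closed_Collect_eq continuous_intros continuous_on_coordinate)
  finally show ?thesis .
qed

lemma compact_spheres: "compact (spheres b n)"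
proof -
  have "compactin (product_topology (\<lambda>_. euclidean) UNIV) (Pi\<^sub>E UNIV (\<lambda>i::nat. Pi\<^sub>E UNIV (\<lambda>j::nat. {-1..1::real})))"
    unfolding compactin_PiE
  proof (intro disjI2 ballI)
    have "compactin (product_topology (\<lambda>_. euclidean) UNIV) (Pi\<^sub>E UNIV (\<lambda>j::nat. {-1..1::real}))"
      unfolding compactin_PiE by simp
    then show "compactin euclidean (Pi\<^sub>E UNIV (\<lambda>j::nat. {-1..1::real}))"
      by (simp add: euclidean_product_topology)
  qed
  then have "compact (Pi\<^sub>E UNIV (\<lambda>i::nat. Pi\<^sub>E UNIV (\<lambda>j::nat. {-1..1::real})))"
    by (simp add: euclidean_product_topology)
  then have "compact (Pi\<^sub>E UNIV (\<lambda>i::nat. Pi\<^sub>E UNIV (\<lambda>j::nat. {-1..1::real})) \<inter> spheres b n)"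
    using closed_spheres by (rule compact_Int_closed)
  also have "Pi\<^sub>E UNIV (\<lambda>i::nat. Pi\<^sub>E UNIV (\<lambda>j::nat. {-1..1::real})) \<inter> spheres b n = spheres b n"
  proof -
    have "- 1 \<le> x i j \<and> x i j \<le> 1" if "x \<in> spheres b n" for x i j
      using spheres_le_1[OF that, of i j] by linarith
    then show ?thesis by (auto simp: PiE_iff)
  qed
  finally show ?thesis .
qed

text \<open>An odd choice of sign on nonzero vectors. It is discontinuous, which is harmless because
  signs of vertices enter only combinatorially.\<close>

definition lead_sign :: "(nat \<Rightarrow> real) \<Rightarrow> bit" where
  "lead_sign v = of_bool (v (LEAST j. v j \<noteq> 0) > 0)"

lemma lead_sign_minus:
  assumes "v j \<noteq> 0"
  shows "lead_sign (\<lambda>j. - v j) = lead_sign v + 1"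
proof -
  have "v (LEAST j. v j \<noteq> 0) \<noteq> 0"
    using assms by (rule LeastI)
  then show ?thesis
    by (auto simp: lead_sign_def)
qed

lemma spheres_nonzero:
  assumes "x \<in> spheres b n" "i < b"
  obtains j where "x i j \<noteq> 0"
proof -
  have "(\<Sum>j\<le>n i. (x i j)\<^sup>2) = 1"
    using assms by (simp add: spheres_def)
  then have "(\<Sum>j\<le>n i. (x i j)\<^sup>2) \<noteq> 0"
    by simp
  then obtain j where "(x i j)\<^sup>2 \<noteq> 0"
    by (rule sum.not_neutral_contains_not_neutral)
  with that show thesis by simp
qed

text \<open>Zeros of \<open>f\<close> are assigned a sign by \<open>lead_sign\<close>, so that the sign of a vertex still has the
  parity of \<open>f\<close> even where \<open>f\<close> vanishes.\<close>

definition vertex_sign :: "(point \<Rightarrow> real) \<Rightarrow> nat set \<Rightarrow> point \<Rightarrow> bit" where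
  "vertex_sign f A x = (if f x = 0 then \<Sum>i\<in>A. lead_sign (x i) else of_bool (f x > 0))"

lemma has_parity_on_vertex_sign:
  assumes "A \<subseteq> {..<b}"
    and "\<And>x i. x \<in> spheres b n \<Longrightarrow> i < b \<Longrightarrow> f (antip i x) = (if i \<in> A then - f x else f x)"
  shows "has_parity_on (spheres b n) b A (vertex_sign f A)"
  unfolding has_parity_on_def
proof (intro ballI allI impI)
  fix x i assume x: "x \<in> spheres b n" "i < b"
  show "vertex_sign f A (antip i x) = vertex_sign f A x + of_bool (i \<in> A)"
  proof (cases "f x = 0")
    case True
    have fin: "finite A"
      using assms(1) finite_subset by blast
    obtain j where j: "x i j \<noteq> 0"
      using spheres_nonzero[OF x] .
    have "(\<Sum>k\<in>A. lead_sign (antip i x k)) = (\<Sum>k\<in>A. lead_sign (x k) + (if k = i then 1 else 0))"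
      using lead_sign_minus[of "x i", OF j] by (intro sum.cong) (auto simp: antip_def)
    also have "\<dots> = (\<Sum>k\<in>A. lead_sign (x k)) + of_bool (i \<in> A)"
      using fin by (simp add: sum.distrib)
    finally show ?thesis
      using True assms(2)[OF x] by (simp add: vertex_sign_def)
  next
    case False
    then show ?thesis
      using assms(2)[OF x] by (auto simp: vertex_sign_def)
  qed
qed

text \<open>The only analytic content of a sign change; the weak inequality also covers zeros with
  an artificial sign and survives limits.\<close>

lemma vertex_sign_neq: "vertex_sign f A x \<noteq> vertex_sign f A y \<Longrightarrow> f x * f y \<le> 0"
  by (auto simp: vertex_sign_def mult_le_0_iff split: if_splits)

lemma near_nth:
  assumes "successively (near \<epsilon>) xs" "l < length xs"
  shows "\<bar>(xs ! l) i j - (xs ! 0) i j\<bar> \<le> real l * \<epsilon>"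
  using assms(2)
proof (induction l)
  case (Suc l)
  then have "\<bar>(xs ! l) i j - (xs ! Suc l) i j\<bar> \<le> \<epsilon>"
    using successively_nth[OF assms(1)] by (simp add: near_def)
  with Suc show ?case
    by (simp add: algebra_simps)
qed simp

text \<open>Take sign-changing tuples of mesh tending to 0. Their length is fixed, so along a
  subsequence all vertices converge to one point \<open>x\<close>. Each function has a nonpositive
  product at two successive vertices, so its square at \<open>x\<close> is nonpositive.\<close>

theorem borsuk_ulam_spheres:
  fixes f :: "'q \<Rightarrow> point \<Rightarrow> real"
  assumes len: "length qs = (\<Sum>i<b. n i)"
    and cont: "\<And>q. q \<in> set qs \<Longrightarrow> continuous_on (spheres b n) (f q)"
    and A: "\<And>q. q \<in> set qs \<Longrightarrow> A q \<subseteq> {..<b}"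
    and f: "\<And>q x i. q \<in> set qs \<Longrightarrow> x \<in> spheres b n \<Longrightarrow> i < b \<Longrightarrow>
          f q (antip i x) = (if i \<in> A q then - f q x else f q x)"
    and top: "top_coeff n (map A qs) = 1"
  shows "\<exists>x\<in>spheres b n. \<forall>q\<in>set qs. f q x = 0"
proof -
  let ?K = "spheres b n"
  define ss where "ss = map (\<lambda>q. vertex_sign (f q) (A q)) qs"
  define sign_changing where "sign_changing \<epsilon> \<sigma> \<longleftrightarrow> set \<sigma> \<subseteq> ?K \<and> successively (near \<epsilon>) \<sigma> \<and>
      length \<sigma> = Suc (length ss) \<and> (\<forall>l<length ss. (ss ! l) (\<sigma> ! l) \<noteq> (ss ! l) (\<sigma> ! Suc l))" for \<epsilon> \<sigma>
  have "\<exists>\<sigma>. sign_changing (pi / Suc M) \<sigma>" for M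
  proof (rule exists_sign_changing_tuple[of "Suc M" "map A qs" ss n b])
    show "map A qs ! l \<subseteq> {..<b} \<and> has_parity_on ?K b (map A qs ! l) (ss ! l)" if "l < length ss" for l
    proof -
      have "qs ! l \<in> set qs"
        using that by (simp add: ss_def)
      with A f have "A (qs ! l) \<subseteq> {..<b}"
        "has_parity_on ?K b (A (qs ! l)) (vertex_sign (f (qs ! l)) (A (qs ! l)))"
        by (auto intro!: has_parity_on_vertex_sign)
      with that show ?thesis
        by (simp add: ss_def)
    qed
  qed (use len top in \<open>auto simp: ss_def sign_changing_def\<close>)
  then obtain \<sigma> where "\<And>M. sign_changing (pi / Suc M) (\<sigma> M)"
    by metis
  then have \<sigma>: "\<And>M. set (\<sigma> M) \<subseteq> ?K" "\<And>M. successively (near (pi / Suc M)) (\<sigma> M)"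
    "\<And>M. length (\<sigma> M) = Suc (length qs)"
    "\<And>M l. l < length qs \<Longrightarrow> (ss ! l) (\<sigma> M ! l) \<noteq> (ss ! l) (\<sigma> M ! Suc l)"
    unfolding sign_changing_def ss_def length_map by blast+
  have in_K: "\<sigma> M ! l \<in> ?K" if "l \<le> length qs" for M l
  proof (rule subsetD[OF \<sigma>(1) nth_mem])
    show "l < length (\<sigma> M)"
      using that by (simp add: \<sigma>(3))
  qed
  have "seq_compact ?K"
    using compact_spheres by (rule compact_eq_seq_compact_metric[THEN iffD1])
  moreover have "\<forall>M. \<sigma> M ! 0 \<in> ?K"
    by (simp add: in_K)
  ultimately obtain x r where x: "x \<in> ?K" and r: "strict_mono r"
    and lim0: "((\<lambda>M. \<sigma> M ! 0) \<circ> r) \<longlonglongrightarrow> x"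
    by (rule seq_compactE)
  have lim: "(\<lambda>M. \<sigma> (r M) ! l) \<longlonglongrightarrow> x" if l: "l \<le> length qs" for l
  proof (intro tendsto_componentwise_fun)
    fix i j
    have "(\<lambda>M. real l * (pi / Suc M)) \<longlonglongrightarrow> 0"
      by real_asymp
    from LIMSEQ_subseq_LIMSEQ[OF this r]
    have "(\<lambda>M. real l * (pi / Suc (r M))) \<longlonglongrightarrow> 0"
      by (simp add: comp_def)
    then have "(\<lambda>M. (\<sigma> (r M) ! l) i j - (\<sigma> (r M) ! 0) i j) \<longlonglongrightarrow> 0"
      by (rule Lim_null_comparison[rotated])
         (use near_nth[OF \<sigma>(2)] \<sigma>(3) l in \<open>auto intro!: always_eventually simp del: of_nat_Suc\<close>)
    moreover have "(\<lambda>M. (\<sigma> (r M) ! 0) i j) \<longlonglongrightarrow> x i j"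
      using continuous_on_tendsto_compose[OF continuous_on_coordinate[of UNIV i j] lim0] by (simp add: comp_def)
    ultimately show "(\<lambda>M. (\<sigma> (r M) ! l) i j) \<longlonglongrightarrow> x i j"
      using tendsto_add by fastforce
  qed
  have "f (qs ! l) x = 0" if l: "l < length qs" for l
  proof -
    have q: "qs ! l \<in> set qs" using l by simp
    have "(\<lambda>M. f (qs ! l) (\<sigma> (r M) ! k)) \<longlonglongrightarrow> f (qs ! l) x" if "k \<le> length qs" for k
      by (rule continuous_on_tendsto_compose[OF cont[OF q] lim[OF that] x]) (simp add: in_K that)
    then have "(\<lambda>M. f (qs ! l) (\<sigma> (r M) ! l) * f (qs ! l) (\<sigma> (r M) ! Suc l)) \<longlonglongrightarrow> f (qs ! l) x * f (qs ! l) x"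
      using l by (intro tendsto_mult) auto
    moreover have "f (qs ! l) (\<sigma> M ! l) * f (qs ! l) (\<sigma> M ! Suc l) \<le> 0" for M
      using \<sigma>(4)[OF l, of M] l by (intro vertex_sign_neq) (simp add: ss_def)
    ultimately have "f (qs ! l) x * f (qs ! l) x \<le> 0"
      by (intro LIMSEQ_le_const2) auto
    then show ?thesis
      by (auto simp: mult_le_0_iff)
  qed
  then have "f q x = 0" if "q \<in> set qs" for q
    using that by (auto simp: in_set_conv_nth)
  with x show ?thesis
    by blast
qed

section \<open>Reduction from the Stiefel manifold\<close>

text \<open>The value 0 beyond block \<open>d - k\<close> makes this function equal to the number of
  equations per block at every index, as \<open>top_coeff_eqn_index\<close> requires.\<close>

definition sphere_dim :: "nat \<Rightarrow> nat \<Rightarrow> nat \<Rightarrow> nat" where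
  "sphere_dim d k i = (if i = 0 then d else if i \<le> d - k then d - 1 else 0)"

text \<open>One equation per dimension of the product of spheres. In block \<open>i > 0\<close> the first \<open>d - i\<close> equations
  are the coordinates of \<open>x\<^sub>i\<close>; the remaining \<open>i - 1\<close> say that \<open>v\<^sub>i\<close> is orthogonal to
  \<open>v\<^sub>1, \<dots>, v\<^bsub>i-1\<^esub>\<close>. The blocks are listed in decreasing order.\<close>

definition eqn_index :: "nat \<Rightarrow> nat \<Rightarrow> nat \<Rightarrow> (nat \<times> nat) list" where
  "eqn_index d k m = concat (map (\<lambda>i. map (Pair i) [0..<sphere_dim d k i]) (rev [0..<m]))"

text \<open>The blocks whose antipode negates the equation. First coordinates carry the extra sign
  of the generator with index 0. The test \<open>i < d\<close> excludes \<open>i = d\<close>, where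
  the factor is trivial and \<open>j = 0\<close> already denotes an orthogonality relation.\<close>

definition eqn_parity :: "nat \<Rightarrow> nat \<times> nat \<Rightarrow> nat set" where
  "eqn_parity d = (\<lambda>(i, j). if i = 0 then {0} else if j = 0 \<and> i < d then {0, i}
     else if j < d - i then {i} else {Suc (j - (d - i)), i})"

lemma set_eqn_index: "set (eqn_index d k m) = {(i, j). i < m \<and> j < sphere_dim d k i}"
  by (auto simp: eqn_index_def)

lemma eqn_index_Suc:
  "eqn_index d k (Suc m) = map (Pair m) [0..<sphere_dim d k m] @ eqn_index d k m"
  by (simp add: eqn_index_def)

lemma length_eqn_index: "length (eqn_index d k m) = (\<Sum>i<m. sphere_dim d k i)"
  by (induction m) (simp_all add: eqn_index_Suc, simp add: eqn_index_def)

lemma count_list_eqn_index: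
  "count_list (map fst (eqn_index d k m)) i = (if i < m then sphere_dim d k i else 0)"
proof (induction m)
  case (Suc m)
  have "count_list (map (\<lambda>_. m) xs) i = (if i = m then length xs else 0)" for xs :: "nat list"
    by (induction xs) auto
  with Suc show ?case
    by (auto simp: eqn_index_Suc comp_def less_Suc_eq)
qed (simp add: eqn_index_def)

lemma sorted_eqn_index: "sorted_wrt (\<ge>) (map fst (eqn_index d k m))"
proof (induction m)
  case (Suc m)
  have "sorted_wrt (\<ge>) (map (\<lambda>_. m) xs)" for xs :: "nat list"
    by (induction xs) auto
  with Suc show ?case
    by (auto simp: eqn_index_Suc comp_def sorted_wrt_append set_eqn_index)
qed (simp add: eqn_index_def)

lemma eqn_parity_le:
  assumes "(i, j) \<in> set (eqn_index d k m)"
  shows "i \<in> eqn_parity d (i, j)" "eqn_parity d (i, j) \<subseteq> {..i}"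
  using assms by (auto simp: set_eqn_index eqn_parity_def sphere_dim_def split: if_splits)

lemma top_coeff_eqn_index:
  "top_coeff (sphere_dim d k) (map (eqn_parity d) (eqn_index d k (Suc (d - k)))) = 1"
proof -
  let ?L = "eqn_index d k (Suc (d - k))"
  let ?ps = "map (\<lambda>q. (fst q, eqn_parity d q)) ?L"
  have "top_coeff (count_list (map fst ?ps)) (map snd ?ps) = 1"
  proof (rule top_coeff_triangular)
    show "sorted_wrt (\<ge>) (map fst ?ps)"
      using sorted_eqn_index by (simp add: comp_def)
    show "\<forall>(i, A)\<in>set ?ps. i \<in> A \<and> A \<subseteq> {..i}"
      using eqn_parity_le by fastforce
  qed
  also have "count_list (map fst ?ps) = sphere_dim d k"
    by (auto simp: comp_def count_list_eqn_index sphere_dim_def)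
  finally show ?thesis
    by (simp add: comp_def)
qed

text \<open>Separates the norm conditions, absorbed by the product of spheres, from the
  orthogonality relations with \<open>l < i\<close>, which become equations.\<close>

lemma X_space_eq:
  "X_space d k = {x \<in> spheres (Suc (d - k)) (sphere_dim d k).
     \<forall>i l. 1 \<le> l \<and> l < i \<and> i \<le> d - k \<longrightarrow> (\<Sum>j<d. x l j * x i j) = 0}" (is "?X = ?Y")
proof (intro set_eqI)
  fix x :: point
  have ball: "(\<forall>i<Suc (d - k). P i) \<longleftrightarrow> P 0 \<and> (\<forall>i\<in>{1..d-k}. P i)" for P
    by (auto simp: less_Suc_eq_le) (metis One_nat_def Suc_leI atLeastAtMost_iff gr0I)
  have beyond: "(\<forall>j>sphere_dim d k i. x i j = 0) \<longleftrightarrow> (\<forall>j\<ge>d. x i j = 0)" if "i \<in> {1..d-k}" for i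
    using that by (auto simp: sphere_dim_def)
  have norm: "(\<Sum>j\<le>sphere_dim d k i. (x i j)\<^sup>2) = (\<Sum>j<d. x i j * x i j)" if "i \<in> {1..d-k}" for i
  proof -
    have "{..sphere_dim d k i} = {..<d}"
      using that by (auto simp: sphere_dim_def)
    then show ?thesis
      by (simp add: power2_eq_square)
  qed
  have orth: "(\<forall>i\<in>{1..d-k}. \<forall>l\<in>{1..d-k}. (\<Sum>j<d. x i j * x l j) = (if i = l then 1 else 0)) \<longleftrightarrow>
      (\<forall>i\<in>{1..d-k}. (\<Sum>j<d. x i j * x i j) = 1) \<and>
      (\<forall>i l. 1 \<le> l \<and> l < i \<and> i \<le> d - k \<longrightarrow> (\<Sum>j<d. x l j * x i j) = 0)" (is "?L \<longleftrightarrow> ?R1 \<and> ?R2")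
  proof (intro iffI conjI)
    assume R: "?R1 \<and> ?R2"
    have "(\<Sum>j<d. x i j * x l j) = 0" if "i \<in> {1..d-k}" "l \<in> {1..d-k}" "i \<noteq> l" for i l
    proof (cases "i < l")
      case True
      with R that show ?thesis by simp
    next
      case False
      with R that have "(\<Sum>j<d. x l j * x i j) = 0" by simp
      then show ?thesis by (simp add: mult.commute)
    qed
    with R show ?L by auto
  qed auto
  show "x \<in> ?X \<longleftrightarrow> x \<in> ?Y"
    unfolding X_space_def spheres_def mem_Collect_eq ball orth
    using beyond norm by (auto simp: sphere_dim_def Suc_le_eq)
qed

lemma closed_X_space: "closed (X_space d k)"
proof -
  have "X_space d k = spheres (Suc (d - k)) (sphere_dim d k) \<inter>
      (\<Inter>i\<in>{..d-k}. \<Inter>l\<in>{1..<i}. {x. (\<Sum>j<d. x l j * x i j) = 0})"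
    by (auto simp: X_space_eq)
  also have "closed \<dots>"
    by (intro closed_Int closed_spheres closed_INT ballI closed_Collect_eq continuous_intros
        continuous_on_coordinate)
  finally show ?thesis .
qed

section \<open>The group action and symmetrised extensions\<close>

lemma finite_G_group: "finite (G_group d k)"
proof (rule finite_surj)
  show "G_group d k \<subseteq> (\<lambda>S i. if i \<in> S then - 1 else 1) ` Pow {..d-k}"
  proof
    fix lam assume lam: "lam \<in> G_group d k"
    then have "lam = (\<lambda>i. if i \<in> {i. i \<le> d - k \<and> lam i = - 1} then - 1 else 1)"
      by (auto simp: G_group_def fun_eq_iff) (metis not_le)
    then show "lam \<in> (\<lambda>S i. if i \<in> S then - 1 else 1) ` Pow {..d-k}"
      by (rule image_eqI) auto
  qed
qed simp

text \<open>The character of the group on coordinate \<open>j\<close> of the factor with index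
  \<open>i\<close>. Its values are signs, hence it is its own inverse.\<close>

definition weight :: "nat \<Rightarrow> nat \<Rightarrow> (nat \<Rightarrow> real) \<Rightarrow> real" where
  "weight i j lam = (if i = 0 then lam 0 else lam i * (if j = 0 then lam 0 else 1))"

lemma weight_square: "lam \<in> G_group d k \<Longrightarrow> i \<le> d - k \<Longrightarrow> weight i j lam * weight i j lam = 1"
  by (auto simp: weight_def G_group_def) (metis le0 mult.right_neutral mult_minus1_right minus_minus)+

lemma act_X_in_X_space:
  assumes lam: "lam \<in> G_group d k" and x: "x \<in> X_space d k"
  shows "act_X lam x \<in> X_space d k"
proof -
  have square: "(lam i * r)\<^sup>2 = r\<^sup>2" if "i < Suc (d - k)" for i r
    using lam that by (auto simp: G_group_def less_Suc_eq_le power_mult_distrib)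
  have "act_X lam x \<in> spheres (Suc (d - k)) (sphere_dim d k)"
    using x unfolding X_space_eq spheres_def act_X_def by (auto simp: square)
  moreover have "(\<Sum>j<d. act_X lam x l j * act_X lam x i j) = lam l * lam i * (\<Sum>j<d. x l j * x i j)" for i l
    by (simp add: act_X_def sum_distrib_left mult_ac)
  ultimately show ?thesis
    using x by (simp add: X_space_eq)
qed

text \<open>A Tietze extension \<open>h\<close> need not respect the symmetry. Its sum over the
  group, weighted by the character, has the right parity everywhere; on \<open>X_space d k\<close>
  all summands equal \<open>f x i j\<close>, so the constant \<open>c\<close> is the group
  order.\<close>

lemma equivariant_extension:
  fixes f :: "point \<Rightarrow> point"
  assumes cont: "continuous_on (X_space d k) f"
    and equiv: "\<forall>lam\<in>G_group d k. \<forall>x\<in>X_space d k. f (act_X lam x) = act_R lam (f x)"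
    and i: "i \<le> d - k"
  obtains g c where "continuous_on UNIV g" "c \<noteq> 0" "\<And>x. x \<in> X_space d k \<Longrightarrow> g x = c * f x i j"
    "\<And>x l. l \<le> d - k \<Longrightarrow>
      g (antip l x) = (if l = i \<or> l = 0 \<and> j = 0 then - g x else g x)"
proof -
  let ?G = "G_group d k"
  have "continuous_on (X_space d k) (\<lambda>x. f x i j)"
    using continuous_on_product_then_coordinatewise[OF continuous_on_product_then_coordinatewise[OF cont]] .
  then obtain h where h: "continuous_on UNIV h" "\<And>x. x \<in> X_space d k \<Longrightarrow> h x = f x i j"
    using Dugundji[of "UNIV :: real set" UNIV "X_space d k" "\<lambda>x. f x i j"] closed_X_space by auto
  define g where "g x = (\<Sum>lam\<in>?G. weight i j lam * h (act_X lam x))" for x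
  have act: "continuous_on UNIV (act_X lam)" for lam
    unfolding act_X_def
    by (intro continuous_on_coordinatewise_then_product continuous_intros continuous_on_coordinate)
  have "continuous_on UNIV g"
    unfolding g_def
    by (intro continuous_on_sum continuous_on_mult continuous_on_const continuous_on_compose2[OF h(1) act]) auto
  moreover have "real (card ?G) \<noteq> 0"
  proof -
    have "(\<lambda>_. 1) \<in> ?G" by (simp add: G_group_def)
    then show ?thesis using finite_G_group by auto
  qed
  moreover have "g x = real (card ?G) * f x i j" if x: "x \<in> X_space d k" for x
  proof -
    have "weight i j lam * h (act_X lam x) = f x i j" if lam: "lam \<in> ?G" for lam
    proof -
      have "h (act_X lam x) = weight i j lam * f x i j"
        using h(2) equiv lam x act_X_in_X_space[OF lam x] by (simp add: act_R_def weight_def)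
      then show ?thesis
        using weight_square[OF lam i] by (simp flip: mult.assoc)
    qed
    then show ?thesis by (simp add: g_def)
  qed
  moreover have "g (antip l x) = (if l = i \<or> l = 0 \<and> j = 0 then - g x else g x)" if l: "l \<le> d - k" for l x
  proof -
    let ?e = "if l = i \<or> l = 0 \<and> j = 0 then - 1 else 1 :: real"
    \<comment> \<open>Changing the sign with index \<open>l\<close> is an involution of the group;
      reindexing by it turns \<open>antip l\<close> into a factor from the character.\<close>
    define \<tau> where "\<tau> lam = lam(l := - lam l)" for lam :: "nat \<Rightarrow> real"
    have \<tau>: "\<tau> lam \<in> ?G" "\<tau> (\<tau> lam) = lam" if "lam \<in> ?G" for lam
      using that l by (auto simp: \<tau>_def G_group_def)
    have w: "weight i j (\<tau> lam) = ?e * weight i j lam" for lam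
      by (auto simp: weight_def \<tau>_def)
    have "g (antip l x) = (\<Sum>lam\<in>?G. weight i j lam * h (act_X (\<tau> lam) x))"
      unfolding g_def by (intro sum.cong refl arg_cong2[of _ _ _ _ "(*)"] arg_cong[of _ _ h])
        (auto simp: act_X_def antip_def \<tau>_def fun_eq_iff)
    also have "\<dots> = (\<Sum>lam\<in>?G. weight i j (\<tau> lam) * h (act_X lam x))"
      by (rule sum.reindex_bij_witness[of _ \<tau> \<tau>]) (simp_all add: \<tau>)
    also have "\<dots> = ?e * g x"
      by (simp add: w g_def sum_distrib_left mult.assoc)
    finally show ?thesis by simp
  qed
  ultimately show thesis by (rule that)
qed

theorem theorem2p1:
  fixes d k :: nat and f :: "(nat \<Rightarrow> nat \<Rightarrow> real) \<Rightarrow> (nat \<Rightarrow> nat \<Rightarrow> real)"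
  assumes "k \<le> d"
    and "continuous_on (X_space d k) f"
    and "f ` X_space d k \<subseteq> R_space d k"
    and "\<forall>lam\<in>G_group d k. \<forall>x\<in>X_space d k. f (act_X lam x) = act_R lam (f x)"
  shows "\<exists>x\<in>X_space d k. f x = (\<lambda>i j. 0)"
proof -
  let ?n = "sphere_dim d k" and ?b = "Suc (d - k)"
  let ?L = "eqn_index d k ?b"
  have "\<forall>i j. \<exists>g :: point \<Rightarrow> real. i \<le> d - k \<longrightarrow> continuous_on UNIV g \<and> (\<forall>x\<in>X_space d k. g x = 0 \<longrightarrow> f x i j = 0) \<and>
      (\<forall>l x. l \<le> d - k \<longrightarrow> g (antip l x) = (if l = i \<or> l = 0 \<and> j = 0 then - g x else g x))"
  proof (intro allI)
    fix i j
    show "\<exists>g :: point \<Rightarrow> real. i \<le> d - k \<longrightarrow> continuous_on UNIV g \<and> (\<forall>x\<in>X_space d k. g x = 0 \<longrightarrow> f x i j = 0) \<and>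
      (\<forall>l x. l \<le> d - k \<longrightarrow> g (antip l x) = (if l = i \<or> l = 0 \<and> j = 0 then - g x else g x))"
    proof (cases "i \<le> d - k")
      case True
      obtain g c where "continuous_on UNIV g" "c \<noteq> 0" "\<And>x. x \<in> X_space d k \<Longrightarrow> g x = c * f x i j"
        "\<And>x l. l \<le> d - k \<Longrightarrow> g (antip l x) = (if l = i \<or> l = 0 \<and> j = 0 then - g x else g x)"
        using equivariant_extension[OF assms(2,4) True, of j] by metis
      then show ?thesis by (intro exI[of _ g]) simp
    qed simp
  qed
  then obtain g :: "nat \<Rightarrow> nat \<Rightarrow> point \<Rightarrow> real"
    where g: "\<forall>i j. i \<le> d - k \<longrightarrow> continuous_on UNIV (g i j) \<and>
      (\<forall>x\<in>X_space d k. g i j x = 0 \<longrightarrow> f x i j = 0) \<and>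
      (\<forall>l x. l \<le> d - k \<longrightarrow> g i j (antip l x) = (if l = i \<or> l = 0 \<and> j = 0 then - g i j x else g i j x))"
    unfolding choice_iff by blast
  have cont: "continuous_on UNIV (g i j)"
    and zero: "x \<in> X_space d k \<Longrightarrow> g i j x = 0 \<Longrightarrow> f x i j = 0"
    and sign: "l \<le> d - k \<Longrightarrow> g i j (antip l x) = (if l = i \<or> l = 0 \<and> j = 0 then - g i j x else g i j x)"
    if "i \<le> d - k" for i j l x
    using g that by auto
  \<comment> \<open>For \<open>j = d - i + p\<close> with \<open>p < i - 1\<close> the equation is
    the inner product of block \<open>Suc p\<close> with block \<open>i\<close>.\<close>
  define F where "F q x = (case q of (i, j) \<Rightarrow> if j < d - i then g i j x
    else \<Sum>c<d. x (Suc (j - (d - i))) c * x i c)" for q and x :: point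
  have "\<exists>x\<in>spheres ?b ?n. \<forall>q\<in>set ?L. F q x = 0"
  proof (rule borsuk_ulam_spheres)
    show "length ?L = (\<Sum>i<?b. ?n i)"
      by (rule length_eqn_index)
    show "top_coeff ?n (map (eqn_parity d) ?L) = 1"
      by (rule top_coeff_eqn_index)
  next
    fix q assume q: "q \<in> set ?L"
    obtain i j where ij: "q = (i, j)" "i \<le> d - k" "j < ?n i"
      using q by (auto simp: set_eqn_index)
    have "continuous_on UNIV (F q)"
      using cont[OF ij(2)] unfolding F_def ij(1) prod.case
      by (cases "j < d - i") (auto intro!: continuous_intros continuous_on_coordinate)
    then show "continuous_on (spheres ?b ?n) (F q)"
      by (rule continuous_on_subset) simp
    show "eqn_parity d q \<subseteq> {..<?b}"
      using eqn_parity_le(2)[of i j d k ?b] q ij by auto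
    show "F q (antip l x) = (if l \<in> eqn_parity d q then - F q x else F q x)" if "l < ?b" for x l
    proof (cases "j < d - i")
      case True
      with that ij show ?thesis
        by (auto simp: F_def eqn_parity_def sign)
    next
      case False
      let ?p = "Suc (j - (d - i))"
      \<comment> \<open>The bound \<open>j < d - 1\<close> keeps the partner index strictly between
        0 and \<open>i\<close>, so the two blocks are distinct and a flip in either one negates the
        inner product.\<close>
      have "?p < i" "i \<noteq> 0"
        using False ij by (auto simp: sphere_dim_def split: if_splits)
      have parity: "eqn_parity d q = {?p, i}"
        using False ij(1) \<open>i \<noteq> 0\<close> by (auto simp: eqn_parity_def)
      have "antip l x ?p c * antip l x i c = (if l \<in> {?p, i} then - 1 else 1) * (x ?p c * x i c)" for c
        using \<open>?p < i\<close> by (auto simp: antip_def)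
      then have "F q (antip l x) = (if l \<in> {?p, i} then - 1 else 1) * F q x"
        using False by (simp only: F_def ij(1) prod.case if_False sum_distrib_left)
      then show ?thesis
        unfolding parity by simp
    qed
  qed
  then obtain x where x: "x \<in> spheres ?b ?n" and F: "\<And>q. q \<in> set ?L \<Longrightarrow> F q x = 0"
    by blast
  have X: "x \<in> X_space d k"
    unfolding X_space_eq
  proof (intro CollectI conjI allI impI x)
    fix i l assume il: "1 \<le> l \<and> l < i \<and> i \<le> d - k"
    then obtain p where p: "l = Suc p"
      by (cases l) auto
    have "F (i, d - i + p) x = 0"
      using il p by (intro F) (auto simp: set_eqn_index sphere_dim_def)
    then show "(\<Sum>j<d. x l j * x i j) = 0"
      using p by (simp add: F_def)
  qed
  have "f x i j = 0" for i j
  proof (cases "i \<le> d - k \<and> j < d - i")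
    case True
    then have "F (i, j) x = 0"
      by (intro F) (auto simp: set_eqn_index sphere_dim_def)
    with True X show ?thesis
      by (simp add: F_def zero)
  next
    \<comment> \<open>These coordinates lie outside the carrier of \<open>R_space d k\<close> and
      vanish by definition.\<close>
    case False
    then show ?thesis
      using X assms(3) by (auto simp: R_space_def not_le not_less)
  qed
  with X show ?thesis
    by blast
qed

end
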